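(* $M(n)\ge F_{n+1}$, where $M(n)$ is the maximal number of facets of a polytope that is the closure of a region, lying in the positive orthant, of the hyperplane arrangement $\mathcal{H}_n$ associated with comparative probability orders on $n$ atoms, and $F_k$ is the $k$th Fibonacci number ($F_1=F_2=1$, $F_{k+2}=F_{k+1}+F_k$).
   Context: Let $[n]=\{1,\dots,n\}$ be the set of atoms. For disjoint subsets $A,B\subseteq[n]$, at least one of which is nonempty, let $H(A,B)\subset\mathbb{R}^n$ be the hyperplane $\sum_{a\in A}x_a-\sum_{b\in B}x_b=0$. Let $\mathcal{A}_n$ be the arrangement of all these hyperplanes, let $J$ be the affine hyperplane $x_1+\dots+x_n=1$, and let $\mathcal{H}_n$ be the arrangement induced on $J$ by $\mathcal{A}_n$ (consisting of the intersections $H(A,B)\cap J$). The regions of $\mathcal{H}_n$ considered are the connected components of the complement in $J$ of the union of these intersections that lie in the positive orthant $\mathbb{R}^n_+$; the closure of each such region is a polytope. These regions correspond to the representable comparative probability orders on $[n]$, that is, the linear orders on $2^{[n]}$ given by $A\preceq B$ if and only if $\sum_{i\in A}p_i\le\sum_{i\in B}p_i$, where $(p_1,\dots,p_n)$ is a probability measure on $[n]$ for which all events have distinct probabilities. *)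

theory Defs
  imports "HOL-Analysis.Analysis" "HOL-Number_Theory.Fib"
begin

text \<open>
  The atoms are the elements of a finite type \<open>'n\<close>, so \<open>n = CARD('n) \<ge> 1\<close> and the ambient
  space is \<open>real ^ 'n\<close>.
\<close>

definition event_hyperplane :: "'n::finite set \<Rightarrow> 'n set \<Rightarrow> (real ^ 'n) set"
  where "event_hyperplane A B = {x. (\<Sum>a\<in>A. x $ a) - (\<Sum>b\<in>B. x $ b) = 0}"

definition event_arrangement :: "(real ^ 'n::finite) set set"
  where "event_arrangement =
    {event_hyperplane A B | A B. A \<inter> B = {} \<and> (A \<noteq> {} \<or> B \<noteq> {})}"

definition unit_sum_hyperplane :: "(real ^ 'n::finite) set"
  where "unit_sum_hyperplane = {x. (\<Sum>i\<in>UNIV. x $ i) = 1}"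

definition induced_arrangement :: "(real ^ 'n::finite) set set"
  where "induced_arrangement = (\<lambda>H. H \<inter> unit_sum_hyperplane) ` event_arrangement"

definition positive_orthant :: "(real ^ 'n::finite) set"
  where "positive_orthant = {x. \<forall>i. 0 < x $ i}"

definition positive_regions :: "(real ^ 'n::finite) set set"
  where "positive_regions =
    {R \<in> components (unit_sum_hyperplane - \<Union>induced_arrangement). R \<subseteq> positive_orthant}"

text \<open>
  A facet is a face of codimension one, and the empty set is a face of dimension \<open>-1\<close>. The library's
  \<^const>\<open>facet_of\<close> additionally asks for a nonempty face. This matters only for a
  zero-dimensional polytope, that is for \<open>n = 1\<close>, where the one region is a point: its only facet
  is the empty face.
\<close>

definition facets :: "'a::euclidean_space set \<Rightarrow> 'a set set"
  where "facets P = {F. F face_of P \<and> aff_dim F = aff_dim P - 1}"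

lemma facets_eq_facet_of: "aff_dim P \<noteq> 0 \<Longrightarrow> facets P = {F. F facet_of P}"
  by (auto simp: facets_def facet_of_def)

text \<open>The number \<open>M(n)\<close> for \<open>n = CARD('n)\<close>.\<close>

definition max_facets :: "'n::finite itself \<Rightarrow> nat"
  where "max_facets _ =
    Max ((\<lambda>R. card (facets (closure R))) ` (positive_regions :: (real ^ 'n) set set))"

end

(* Identify a hyperplane H(A,B) with its signed normal in {-1,0,1}^n. Let p be a positive integer
   point with u.p \<noteq> 0 for all signed u \<noteq> 0, and let v be signed with v.p = 1. For any other signed u with
   u.p > 0, the projection x = p - v/(v.v) satisfies u.x > 0: if u.p \<ge> 2 because u.v \<le> v.v, and
   if u.p = 1 provided u.v < v.v. So every such v is the normal of a facet of the region of p.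

   Take p = (J, 2, 4, ..., 2^(n-1)) with J the n-th Jacobsthal number, which is odd. Comparing
   modulo 2^(k+1) shows that two signed vectors with the same value at p have opposite nonzero
   entries at the first index k where they differ; this gives both u.p \<noteq> 0 and u.v < v.v. The v with
   v.p = 1 correspond to the n-digit binary representations of J with digits -1, 0, 1, and as
   J is close to 2^n/3 there are F(n+1) of these (the maximum of Stern's diatomic sequence). *)

theory Submission
  imports Defs
begin

section \<open>Polyhedral cells\<close>

text \<open>Used with \<open>T\<close> the unit-sum hyperplane and \<open>U\<close> the signed
  vectors that are positive at a chosen point: a region is then an open cell and its closure the
  closed cell.\<close>

definition open_cell :: "'a::euclidean_space set \<Rightarrow> 'a set \<Rightarrow> 'a set"
  where "open_cell T U = T \<inter> {x. \<forall>u\<in>U. 0 < u \<bullet> x}"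

definition closed_cell :: "'a::euclidean_space set \<Rightarrow> 'a set \<Rightarrow> 'a set"
  where "closed_cell T U = T \<inter> {x. \<forall>u\<in>U. 0 \<le> u \<bullet> x}"

lemma open_cell_eq: "open_cell T U = T \<inter> (\<Inter>u\<in>U. {x. 0 < u \<bullet> x})"
  by (auto simp: open_cell_def)

lemma closed_cell_eq: "closed_cell T U = T \<inter> (\<Inter>u\<in>U. {x. 0 \<le> u \<bullet> x})"
  by (auto simp: closed_cell_def)

lemma convex_open_cell: "affine T \<Longrightarrow> convex (open_cell T U)"
  unfolding open_cell_eq
  by (intro convex_Int convex_INT convex_halfspace_gt) (rule affine_imp_convex)

lemma convex_closed_cell: "affine T \<Longrightarrow> convex (closed_cell T U)"
  unfolding closed_cell_eq
  by (intro convex_Int convex_INT convex_halfspace_ge) (rule affine_imp_convex)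

lemma polyhedron_closed_cell:
  assumes "affine T" "finite U"
  shows "polyhedron (closed_cell T U)"
  unfolding closed_cell_eq
  using assms
  by (intro polyhedron_Int polyhedron_Inter)
    (auto intro: polyhedron_halfspace_ge affine_imp_polyhedron)

text \<open>A segment from the interior point \<open>p\<close> to a point \<open>x\<close> of the
  closed cell stays in the open cell except possibly at \<open>x\<close>, so \<open>x\<close> is a
  limit of points of the open cell.\<close>

lemma closure_open_cell:
  assumes "affine T" "finite U" "p \<in> open_cell T U"
  shows "closure (open_cell T U) = closed_cell T U"
proof
  have "closed (closed_cell T U)"
    using assms by (intro polyhedron_imp_closed polyhedron_closed_cell)
  then show "closure (open_cell T U) \<subseteq> closed_cell T U"
    by (intro closure_minimal) (auto simp: open_cell_def closed_cell_def less_imp_le)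
next
  show "closed_cell T U \<subseteq> closure (open_cell T U)"
  proof
    fix x assume x: "x \<in> closed_cell T U"
    show "x \<in> closure (open_cell T U)"
    proof (cases "x = p")
      case True
      then show ?thesis using assms(3) closure_subset by blast
    next
      case False
      have "open_segment p x \<subseteq> open_cell T U"
      proof
        fix y assume "y \<in> open_segment p x"
        then obtain t where t: "0 < t" "t < 1" and y: "y = (1 - t) *\<^sub>R p + t *\<^sub>R x"
          by (auto simp: in_segment)
        have "y \<in> T"
          using assms(1,3) x t mem_affine[of T p x "1 - t" t]
          by (simp add: y open_cell_def closed_cell_def)
        moreover have "0 < u \<bullet> y" if "u \<in> U" for u
          using that assms(3) x t
          by (auto simp: y inner_add_right open_cell_def closed_cell_def intro!: add_pos_nonneg)
        ultimately show "y \<in> open_cell T U" by (simp add: open_cell_def)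
      qed
      from closure_mono[OF this] have "closed_segment p x \<subseteq> closure (open_cell T U)"
        using False by simp
      then show ?thesis by auto
    qed
  qed
qed

text \<open>The open cell is relatively open in \<open>T\<close> and nonempty, hence already has
  full dimension.\<close>

lemma aff_dim_closed_cell:
  assumes "affine T" "finite U" "p \<in> open_cell T U"
  shows "aff_dim (closed_cell T U) = aff_dim T"
proof (rule antisym)
  show "aff_dim (closed_cell T U) \<le> aff_dim T"
    by (intro aff_dim_subset) (auto simp: closed_cell_def)
  have "open (\<Inter>u\<in>U. {x. 0 < u \<bullet> x})"
    using assms(2) by (intro open_INT) (auto intro: open_halfspace_gt)
  then have "openin (top_of_set T) (open_cell T U)"
    unfolding open_cell_eq by (simp add: openin_open_Int)
  then have "aff_dim (open_cell T U) = aff_dim T"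
    using assms by (intro aff_dim_openin) auto
  moreover have "aff_dim (open_cell T U) \<le> aff_dim (closed_cell T U)"
    by (intro aff_dim_subset) (auto simp: open_cell_def closed_cell_def less_imp_le)
  ultimately show "aff_dim T \<le> aff_dim (closed_cell T U)" by simp
qed

text \<open>The point \<open>x\<close> certifies that the constraint \<open>v\<close> is
  irredundant: it violates strictness for \<open>v\<close> alone.\<close>

lemma closed_cell_facet:
  assumes T: "affine T" and U: "finite U" "v \<in> U" and p: "p \<in> open_cell T U"
    and x: "x \<in> open_cell T (U - {v})" "v \<bullet> x = 0"
  shows "closed_cell T U \<inter> {y. v \<bullet> y = 0} \<in> facets (closed_cell T U)"
proof -
  have "closed_cell T U \<inter> {y. v \<bullet> y = 0} face_of closed_cell T U"
    using convex_closed_cell[OF T] U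
    by (intro face_of_Int_supporting_hyperplane_ge) (auto simp: closed_cell_def)
  \<comment> \<open>The face is again a closed cell, now inside
    \<open>T \<inter> {y. v \<bullet> y = 0}\<close>, with \<open>x\<close> as interior point. Its
    dimension is therefore that of this slice, which is one less than \<open>T\<close> because
    \<open>p\<close> lies off the hyperplane.\<close>
  moreover have "closed_cell T U \<inter> {y. v \<bullet> y = 0} = closed_cell (T \<inter> {y. v \<bullet> y = 0}) (U - {v})"
    by (auto simp: closed_cell_def)
  moreover have "aff_dim (closed_cell (T \<inter> {y. v \<bullet> y = 0}) (U - {v})) = aff_dim (T \<inter> {y. v \<bullet> y = 0})"
    using x U T
    by (intro aff_dim_closed_cell[where p = x] affine_Int affine_hyperplane) (auto simp: open_cell_def)
  moreover have "aff_dim (T \<inter> {y. v \<bullet> y = 0}) = aff_dim T - 1"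
  proof -
    have "x \<in> T \<inter> {y. v \<bullet> y = 0}" using x by (auto simp: open_cell_def)
    moreover have "p \<in> T" "v \<bullet> p \<noteq> 0" using p U by (auto simp: open_cell_def)
    ultimately show ?thesis
      using aff_dim_affine_Int_hyperplane[OF T, of v 0] by auto
  qed
  ultimately show ?thesis
    using aff_dim_closed_cell[OF T U(1) p] by (simp add: facets_def)
qed

lemma finite_facets: "polyhedron P \<Longrightarrow> finite (facets P)"
  using finite_polyhedron_faces[of P] by (rule finite_subset[rotated]) (auto simp: facets_def)

section \<open>Regions as cells\<close>

definition signed_vectors :: "(real ^ 'n::finite) set"
  where "signed_vectors = {u. \<forall>i. u $ i \<in> {-1, 0, 1}}"

lemma finite_signed_vectors: "finite (signed_vectors :: (real ^ 'n::finite) set)"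
proof -
  have "signed_vectors \<subseteq> vec_lambda ` (PiE (UNIV :: 'n set) (\<lambda>_. {-1, 0, 1 :: real}))"
  proof
    fix u :: "real ^ 'n" assume "u \<in> signed_vectors"
    then have "vec_nth u \<in> PiE UNIV (\<lambda>_. {-1, 0, 1})" by (auto simp: signed_vectors_def)
    then show "u \<in> vec_lambda ` (PiE UNIV (\<lambda>_. {-1, 0, 1}))"
      by (metis image_eqI vec_nth_inverse)
  qed
  then show ?thesis by (rule finite_subset) (intro finite_imageI finite_PiE; simp)
qed

lemma uminus_signed_vectors: "u \<in> signed_vectors \<Longrightarrow> - u \<in> signed_vectors"
  by (auto simp: signed_vectors_def)

lemma unit_sum_hyperplane_eq: "unit_sum_hyperplane = {x. (1 :: real ^ 'n::finite) \<bullet> x = 1}"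
  by (simp add: unit_sum_hyperplane_def inner_vec_def)

lemma affine_unit_sum_hyperplane: "affine unit_sum_hyperplane"
  unfolding unit_sum_hyperplane_eq by (rule affine_hyperplane)

lemma signed_sum_eq_inner:
  fixes A B :: "'n::finite set" and x :: "real ^ 'n"
  assumes "A \<inter> B = {}"
  shows "(\<Sum>a\<in>A. x $ a) - (\<Sum>b\<in>B. x $ b) = (\<chi> i. if i \<in> A then 1 else if i \<in> B then -1 else 0) \<bullet> x"
proof -
  have "(\<chi> i. if i \<in> A then 1 else if i \<in> B then -1 else 0) \<bullet> x
      = (\<Sum>i\<in>UNIV. (if i \<in> A then x $ i else 0) - (if i \<in> B then x $ i else 0))"
    using assms by (auto simp: inner_vec_def intro!: sum.cong)
  then show ?thesis by (simp add: sum_subtractf sum.If_cases)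
qed

text \<open>A disjoint pair \<open>A\<close>, \<open>B\<close> corresponds to the signed vector that
  is 1 on \<open>A\<close>, -1 on \<open>B\<close> and 0 elsewhere; the excluded empty pair is the
  zero vector.\<close>

lemma Union_induced_arrangement:
  "(x \<in> unit_sum_hyperplane - \<Union>induced_arrangement) \<longleftrightarrow>
   x \<in> unit_sum_hyperplane \<and> (\<forall>u\<in>signed_vectors - {0}. u \<bullet> (x :: real ^ 'n::finite) \<noteq> 0)"
proof (cases "x \<in> unit_sum_hyperplane")
  case True
  have "x \<in> \<Union>induced_arrangement \<longleftrightarrow> (\<exists>u\<in>signed_vectors - {0}. u \<bullet> x = 0)"
  proof
    assume "x \<in> \<Union>induced_arrangement"
    then obtain A B :: "'n set" where AB: "A \<inter> B = {}" "A \<noteq> {} \<or> B \<noteq> {}"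
      and "x \<in> event_hyperplane A B"
      by (auto simp: induced_arrangement_def event_arrangement_def)
    define u :: "real ^ 'n" where "u = (\<chi> i. if i \<in> A then 1 else if i \<in> B then -1 else 0)"
    have "u \<bullet> x = 0"
      using \<open>x \<in> event_hyperplane A B\<close> AB signed_sum_eq_inner[of A B x]
      by (simp add: event_hyperplane_def u_def)
    moreover obtain i where "i \<in> A \<union> B" using AB by auto
    then have "u $ i \<noteq> 0" by (auto simp: u_def)
    then have "u \<noteq> 0" by auto
    moreover have "u \<in> signed_vectors" by (simp add: signed_vectors_def u_def)
    ultimately show "\<exists>u\<in>signed_vectors - {0}. u \<bullet> x = 0" by blast
  next
    assume "\<exists>u\<in>signed_vectors - {0}. u \<bullet> x = 0"
    then obtain u where u: "\<And>i. u $ i \<in> {-1, 0, 1}" "u \<noteq> 0" "u \<bullet> x = 0"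
      by (auto simp: signed_vectors_def)
    define A where "A = {i. u $ i = 1}"
    define B where "B = {i. u $ i = -1}"
    have "A \<inter> B = {}" by (auto simp: A_def B_def)
    moreover have "u = (\<chi> i. if i \<in> A then 1 else if i \<in> B then -1 else 0)"
      using u(1) by (auto simp: vec_eq_iff A_def B_def)
    ultimately have "x \<in> event_hyperplane A B"
      using u(3) signed_sum_eq_inner[of A B x] by (simp add: event_hyperplane_def)
    moreover have "A \<noteq> {} \<or> B \<noteq> {}"
      using u(1,2) by (fastforce simp: vec_eq_iff A_def B_def)
    ultimately show "x \<in> \<Union>induced_arrangement"
      using True \<open>A \<inter> B = {}\<close> by (auto simp: induced_arrangement_def event_arrangement_def)
  qed
  then show ?thesis using True by auto
qed auto

text \<open>The cell is convex, hence connected, and a connected set through \<open>p\<close> that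
  leaves it must meet one of the hyperplanes by the intermediate value theorem.\<close>

lemma component_eq_open_cell:
  fixes p :: "real ^ 'n::finite"
  assumes "p \<in> unit_sum_hyperplane - \<Union>induced_arrangement" (is "p \<in> ?S")
  shows "connected_component_set ?S p
    = open_cell unit_sum_hyperplane {u \<in> signed_vectors. 0 < u \<bullet> p}" (is "_ = open_cell _ ?U")
proof (rule connected_component_unique)
  have p: "p \<in> unit_sum_hyperplane" "\<And>u. u \<in> signed_vectors \<Longrightarrow> u \<noteq> 0 \<Longrightarrow> u \<bullet> p \<noteq> 0"
    using assms Union_induced_arrangement by blast+
  show "p \<in> open_cell unit_sum_hyperplane ?U"
    using p by (simp add: open_cell_def)
  show "connected (open_cell unit_sum_hyperplane ?U)"
    by (intro convex_connected convex_open_cell affine_unit_sum_hyperplane)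
  show "open_cell unit_sum_hyperplane ?U \<subseteq> ?S"
  proof
    fix x assume x: "x \<in> open_cell unit_sum_hyperplane ?U"
    have "u \<bullet> x \<noteq> 0" if "u \<in> signed_vectors - {0}" for u
    proof (cases "0 < u \<bullet> p")
      case True
      then show ?thesis using x that by (auto simp: open_cell_def)
    next
      case False
      \<comment> \<open>Each hyperplane has two normals, and exactly one of them is positive at
        \<open>p\<close>.\<close>
      then have "- u \<in> ?U"
        using p(2)[of u] that by (simp add: uminus_signed_vectors)
      then have "0 < (- u) \<bullet> x" using x unfolding open_cell_def by blast
      then show ?thesis by simp
    qed
    then show "x \<in> ?S" using x Union_induced_arrangement by (auto simp: open_cell_def)
  qed
  fix C assume C: "p \<in> C" "C \<subseteq> ?S" "connected C"
  show "C \<subseteq> open_cell unit_sum_hyperplane ?U"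
  proof
    fix x assume "x \<in> C"
    have "0 < u \<bullet> x" if u: "u \<in> ?U" for u
    proof (rule ccontr)
      assume "\<not> 0 < u \<bullet> x"
      then obtain z where "z \<in> C" "u \<bullet> z = 0"
        using connected_ivt_hyperplane[OF \<open>connected C\<close> \<open>x \<in> C\<close> \<open>p \<in> C\<close>, of u 0] u by auto
      moreover have "u \<noteq> 0" using u by auto
      moreover have "z \<in> ?S" using \<open>z \<in> C\<close> C by blast
      ultimately show False using u Union_induced_arrangement[of z] by blast
    qed
    then show "x \<in> open_cell unit_sum_hyperplane ?U"
      using \<open>x \<in> C\<close> C by (auto simp: open_cell_def)
  qed
qed

text \<open>Makes the \<open>Max\<close> in \<open>max_facets\<close> meaningful. A region is
  determined by a set of signed vectors.\<close>

lemma finite_positive_regions: "finite (positive_regions :: (real ^ 'n::finite) set set)"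
proof -
  have "positive_regions \<subseteq> open_cell unit_sum_hyperplane ` Pow (signed_vectors :: (real ^ 'n) set)"
  proof
    fix R :: "(real ^ 'n) set" assume "R \<in> positive_regions"
    then obtain p where "p \<in> unit_sum_hyperplane - \<Union>induced_arrangement"
      and "R = connected_component_set (unit_sum_hyperplane - \<Union>induced_arrangement) p"
      by (auto simp: positive_regions_def components_def)
    then show "R \<in> open_cell unit_sum_hyperplane ` Pow signed_vectors"
      using component_eq_open_cell by blast
  qed
  then show ?thesis by (rule finite_subset) (simp add: finite_signed_vectors)
qed

text \<open>Allows integer points in place of probability vectors: dividing by the coordinate sum
  preserves all signs. The cell lies in the orthant because the unit vectors are among its
  normals.\<close>

lemma open_cell_positive_region:
  fixes p :: "real ^ 'n::finite"
  assumes pos: "\<And>i. 0 < p $ i"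
    and gen: "\<And>u. u \<in> signed_vectors \<Longrightarrow> u \<noteq> 0 \<Longrightarrow> u \<bullet> p \<noteq> 0"
  defines "U \<equiv> {u \<in> signed_vectors. 0 < u \<bullet> p}"
  shows "open_cell unit_sum_hyperplane U \<in> positive_regions"
    and "p /\<^sub>R (1 \<bullet> p) \<in> open_cell unit_sum_hyperplane U"
proof -
  have s: "0 < 1 \<bullet> p" using pos by (simp add: inner_vec_def sum_pos)
  define q where "q = p /\<^sub>R (1 \<bullet> p)"
  have q: "q \<in> unit_sum_hyperplane" using s by (simp add: q_def unit_sum_hyperplane_eq)
  have U: "U = {u \<in> signed_vectors. 0 < u \<bullet> q}"
    using s by (auto simp: q_def U_def zero_less_mult_iff)
  then show "p /\<^sub>R (1 \<bullet> p) \<in> open_cell unit_sum_hyperplane U"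
    using q by (simp add: open_cell_def flip: q_def)
  have qS: "q \<in> unit_sum_hyperplane - \<Union>induced_arrangement"
    using q s gen by (subst Union_induced_arrangement) (auto simp: q_def)
  have "axis i 1 \<in> U" for i
    using pos by (simp add: U_def signed_vectors_def inner_axis') (simp add: axis_def)
  then have "open_cell unit_sum_hyperplane U \<subseteq> positive_orthant"
    by (fastforce simp: open_cell_def positive_orthant_def inner_axis')
  then show "open_cell unit_sum_hyperplane U \<in> positive_regions"
    using componentsI[OF qS] component_eq_open_cell[OF qS] by (simp add: U positive_regions_def)
qed

section \<open>Facets from signed vectors of value 1 at an integer point\<close>

lemma inner_signed_le:
  assumes "u \<in> signed_vectors" "v \<in> signed_vectors"
  shows "u \<bullet> v \<le> v \<bullet> v"
  unfolding inner_vec_def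
proof (rule sum_mono)
  fix i
  have "u $ i \<in> {-1, 0, 1}" "v $ i \<in> {-1, 0, 1}"
    using assms by (auto simp: signed_vectors_def)
  then show "u $ i \<bullet> v $ i \<le> v $ i \<bullet> v $ i" by auto
qed

lemma inner_signed_less:
  assumes "u \<in> signed_vectors" "v \<in> signed_vectors" "v $ i \<noteq> 0" "u $ i = - v $ i"
  shows "u \<bullet> v < v \<bullet> v"
  unfolding inner_vec_def
proof (rule sum_strict_mono_ex1)
  show "\<forall>i\<in>UNIV. u $ i \<bullet> v $ i \<le> v $ i \<bullet> v $ i"
  proof
    fix i
    have "u $ i \<in> {-1, 0, 1}" "v $ i \<in> {-1, 0, 1}"
      using assms by (auto simp: signed_vectors_def)
    then show "u $ i \<bullet> v $ i \<le> v $ i \<bullet> v $ i" by auto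
  qed
  have "0 < v $ i * v $ i" using assms(3) not_real_square_gt_zero by blast
  then have "u $ i \<bullet> v $ i < v $ i \<bullet> v $ i" using assms(4) by simp
  then show "\<exists>i\<in>UNIV. u $ i \<bullet> v $ i < v $ i \<bullet> v $ i" by blast
qed simp

lemma inner_signed_Ints:
  assumes "u \<in> signed_vectors" "\<And>i. p $ i \<in> \<int>"
  shows "u \<bullet> p \<in> \<int>"
  unfolding inner_vec_def
proof (rule Ints_sum)
  fix i
  have "u $ i \<in> {-1, 0, 1}" using assms by (auto simp: signed_vectors_def)
  then show "u $ i \<bullet> p $ i \<in> \<int>" using assms(2)[of i] by auto
qed

text \<open>By integrality, 1 is the least positive value at \<open>p\<close>. Vectors of value at
  least 2 leave enough slack on their own; \<open>opp\<close> supplies the strict inequality between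
  two vectors of value 1.\<close>

lemma card_facets_ge_minimal_differences:
  fixes p :: "real ^ 'n::finite"
  assumes n: "CARD('n) \<ge> 2"
    and int: "\<And>i. p $ i \<in> \<int>" and pos: "\<And>i. 0 < p $ i"
    and gen: "\<And>u. u \<in> signed_vectors \<Longrightarrow> u \<noteq> 0 \<Longrightarrow> u \<bullet> p \<noteq> 0"
    and opp: "\<And>u v. u \<in> signed_vectors \<Longrightarrow> v \<in> signed_vectors \<Longrightarrow> u \<noteq> v \<Longrightarrow>
      u \<bullet> p = 1 \<Longrightarrow> v \<bullet> p = 1 \<Longrightarrow> \<exists>i. v $ i \<noteq> 0 \<and> u $ i = - v $ i"
  shows "\<exists>R\<in>(positive_regions :: (real ^ 'n) set set).
    card {v \<in> signed_vectors. v \<bullet> p = 1} \<le> card (facets (closure R))"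
proof -
  define U where "U = {u \<in> signed_vectors. 0 < u \<bullet> p}"
  define V where "V = {v \<in> signed_vectors. v \<bullet> p = 1}"
  define P where "P = closed_cell unit_sum_hyperplane U"
  define R where "R = open_cell unit_sum_hyperplane U"
  have finU: "finite U" by (simp add: U_def finite_signed_vectors)
  have R: "R \<in> positive_regions" and p: "p /\<^sub>R (1 \<bullet> p) \<in> R"
    using open_cell_positive_region[OF pos gen] by (simp_all add: R_def U_def)
  have clR: "closure R = P"
    using closure_open_cell[OF affine_unit_sum_hyperplane finU] p by (simp add: R_def P_def)

  \<comment> \<open>With at least two atoms, the all-ones vector has value above 1 at
    \<open>p\<close>, so it lies in \<open>U\<close> but not in \<open>V\<close>.\<close>
  have ge1: "1 \<le> p $ i" for i using int[of i] pos[of i] by (auto elim!: Ints_cases)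
  have "real CARD('n) \<le> 1 \<bullet> p"
    using sum_mono[of UNIV "\<lambda>_. 1" "\<lambda>i. p $ i"] ge1 by (simp add: inner_vec_def)
  then have one: "1 < 1 \<bullet> p" using n by simp

  have VU: "V \<subseteq> U" by (auto simp: U_def V_def)
  have witness: "\<exists>x \<in> open_cell unit_sum_hyperplane (U - {v}). v \<bullet> x = 0" if v: "v \<in> V" for v
  proof -
    \<comment> \<open>The orthogonal projection of \<open>p\<close> to the hyperplane of
      \<open>v\<close>, as \<open>v \<bullet> p = 1\<close>.\<close>
    define x where "x = p - v /\<^sub>R (v \<bullet> v)"
    have vp: "v \<bullet> p = 1" "v \<in> signed_vectors" using v by (auto simp: V_def)
    then have vv: "0 < v \<bullet> v" by auto
    have vx: "v \<bullet> x = 0" using vv vp by (simp add: x_def inner_diff_right)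
    have ux: "0 < u \<bullet> x" if u: "u \<in> U - {v}" for u
    proof -
      have us: "u \<in> signed_vectors" "0 < u \<bullet> p" "u \<noteq> v" using u by (auto simp: U_def)
      have "u \<bullet> v < (u \<bullet> p) * (v \<bullet> v)"
      proof (cases "u \<bullet> p = 1")
        case True
        then show ?thesis
          using opp[OF us(1) vp(2) us(3) True vp(1)] inner_signed_less[OF us(1) vp(2)] by auto
      next
        case False
        then have "2 \<le> u \<bullet> p"
          using inner_signed_Ints[OF us(1) int] us(2) by (auto elim!: Ints_cases)
        then have "2 * (v \<bullet> v) \<le> (u \<bullet> p) * (v \<bullet> v)" using vv by simp
        then show ?thesis using inner_signed_le[OF us(1) vp(2)] vv by linarith
      qed
      then show ?thesis using vv by (simp add: x_def inner_diff_right field_simps)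
    qed
    \<comment> \<open>Applying \<open>ux\<close> to the all-ones vector shows that \<open>x\<close>
      has positive coordinate sum and can be rescaled to sum 1.\<close>
    have "1 \<in> U - {v}"
      using one vp by (auto simp: U_def signed_vectors_def)
    then have sx: "0 < 1 \<bullet> x" by (rule ux)
    have "x /\<^sub>R (1 \<bullet> x) \<in> open_cell unit_sum_hyperplane (U - {v})"
      using sx ux by (auto simp: open_cell_def unit_sum_hyperplane_eq zero_less_mult_iff)
    moreover have "v \<bullet> (x /\<^sub>R (1 \<bullet> x)) = 0" using vx by simp
    ultimately show ?thesis by blast
  qed

  \<comment> \<open>The witness for \<open>v\<close> lies on the facet of \<open>v\<close> but
    strictly inside the half-space of any other \<open>v'\<close>, so the facets differ.\<close>
  have "inj_on (\<lambda>v. P \<inter> {y. v \<bullet> y = 0}) V"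
  proof (rule inj_onI, rule ccontr)
    fix v v' assume v: "v \<in> V" "v' \<in> V" and eq: "P \<inter> {y. v \<bullet> y = 0} = P \<inter> {y. v' \<bullet> y = 0}"
      and "v \<noteq> v'"
    obtain x where x: "x \<in> open_cell unit_sum_hyperplane (U - {v})" "v \<bullet> x = 0"
      using witness[OF v(1)] by blast
    then have "x \<in> P \<inter> {y. v \<bullet> y = 0}"
      by (auto simp: P_def open_cell_def closed_cell_def less_le)
    then have "v' \<bullet> x = 0" using eq by auto
    moreover have "0 < v' \<bullet> x" using x v VU \<open>v \<noteq> v'\<close> by (auto simp: open_cell_def)
    ultimately show False by simp
  qed
  moreover have "(\<lambda>v. P \<inter> {y. v \<bullet> y = 0}) ` V \<subseteq> facets P"
    using witness closed_cell_facet[OF affine_unit_sum_hyperplane finU] VU p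
    unfolding P_def R_def by blast
  moreover have "finite (facets P)"
    using finite_facets polyhedron_closed_cell[OF affine_unit_sum_hyperplane finU] by (simp add: P_def)
  ultimately have "card V \<le> card (facets P)" by (rule card_inj_on_le)
  then show ?thesis using R clR unfolding V_def by auto
qed

section \<open>Signed binary representations of Jacobsthal numbers\<close>

text \<open>Take the index \<open>i\<close> of least exponent at which \<open>u\<close> and
  \<open>v\<close> differ. Modulo \<open>2 ^ Suc (e i)\<close> only its term survives in
  \<open>u \<bullet> p - v \<bullet> p = 0\<close>, so the two digits there differ by an even
  amount.\<close>

lemma first_difference_opposite:
  fixes u v :: "real ^ 'n::finite" and e :: "'n \<Rightarrow> nat" and c :: "'n \<Rightarrow> int"
  assumes "inj e" and odd: "\<And>i. odd (c i)"
    and u: "u \<in> signed_vectors" and v: "v \<in> signed_vectors" and "u \<noteq> v"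
    and p: "\<And>i. p $ i = of_int (2 ^ e i * c i)" and eq: "u \<bullet> p = v \<bullet> p"
  shows "\<exists>i. v $ i \<noteq> 0 \<and> u $ i = - v $ i"
proof -
  define D where "D = {i. u $ i \<noteq> v $ i}"
  have "D \<noteq> {}" using \<open>u \<noteq> v\<close> by (auto simp: D_def vec_eq_iff)
  define i where "i = arg_min_on e D"
  have "i \<in> D" and min: "\<And>j. j \<in> D \<Longrightarrow> e i \<le> e j"
    using arg_min_if_finite[of D e] \<open>D \<noteq> {}\<close> by (auto simp: i_def not_less)
  \<comment> \<open>The floors turn the real digits into integers, so that divisibility can be
    used.\<close>
  define a where "a j = \<lfloor>u $ j\<rfloor> - \<lfloor>v $ j\<rfloor>" for j
  have digit: "u $ j \<in> {-1, 0, 1}" "v $ j \<in> {-1, 0, 1}" for j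
    using u v by (auto simp: signed_vectors_def)
  have a: "of_int (a j) = u $ j - v $ j" for j
    using digit[of j] by (auto simp: a_def)
  have "real_of_int (\<Sum>j\<in>UNIV. a j * (2 ^ e j * c j)) = u \<bullet> p - v \<bullet> p"
    by (simp add: inner_vec_def a p flip: sum_subtractf) (simp add: algebra_simps)
  then have "(\<Sum>j\<in>UNIV. a j * (2 ^ e j * c j)) = 0" using eq by (simp flip: of_int_sum)
  then have "a i * (2 ^ e i * c i) = - (\<Sum>j\<in>UNIV - {i}. a j * (2 ^ e j * c j))"
    by (subst (asm) sum.remove[of _ i]) auto
  moreover have "2 ^ Suc (e i) dvd (\<Sum>j\<in>UNIV - {i}. a j * (2 ^ e j * c j))"
  proof (rule dvd_sum)
    fix j assume j: "j \<in> UNIV - {i}"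
    show "2 ^ Suc (e i) dvd a j * (2 ^ e j * c j)"
    proof (cases "j \<in> D")
      case True
      then have "Suc (e i) \<le> e j"
        using min[OF True] j inj_eq[OF \<open>inj e\<close>, of i j] by auto
      then show ?thesis by (intro dvd_mult dvd_mult2 le_imp_power_dvd)
    next
      case False
      then show ?thesis by (auto simp: D_def a_def)
    qed
  qed
  ultimately have "2 ^ Suc (e i) dvd a i * (2 ^ e i * c i)"
    by (simp only: dvd_minus_iff)
  then have "2 ^ e i * 2 dvd 2 ^ e i * (a i * c i)" by (simp add: ac_simps)
  then have "even (a i * c i)" unfolding dvd_mult_cancel_left by simp
  then have even: "even (a i)" using odd[of i] by simp
  have "a i \<noteq> 0" using a[of i] \<open>i \<in> D\<close> by (auto simp: D_def)
  \<comment> \<open>A nonzero even difference of digits from {-1, 0, 1} is 2 or -2, which forces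
    opposite digits 1 and -1.\<close>
  then have "v $ i \<noteq> 0 \<and> u $ i = - v $ i"
    using digit[of i] even floor_of_int[of "-1", where 'a = real] by (auto simp: a_def)
  then show ?thesis ..
qed

text \<open>Digits are listed from the least significant one; zeros pad to the fixed length.\<close>

definition signed_binary :: "nat \<Rightarrow> int \<Rightarrow> int list set"
  where "signed_binary m N =
    {ds. length ds = m \<and> set ds \<subseteq> {-1, 0, 1} \<and> horner_sum id 2 ds = N}"

lemma finite_signed_binary: "finite (signed_binary m N)"
  by (rule finite_subset[OF _ finite_lists_length_eq[of "{-1, 0, 1}" m]])
    (auto simp: signed_binary_def)

text \<open>The sequence 0, 1, 1, 3, 5, 11, ..., in closed form (2^n - (-1)^n)/3.\<close>

fun jacobsthal :: "nat \<Rightarrow> int"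
  where
    "jacobsthal 0 = 0"
  | "jacobsthal (Suc 0) = 1"
  | "jacobsthal (Suc (Suc n)) = jacobsthal (Suc n) + 2 * jacobsthal n"

lemma jacobsthal_Suc: "jacobsthal (Suc n) = 2 * jacobsthal n + (-1) ^ n"
  by (induction n rule: jacobsthal.induct) auto

lemma odd_jacobsthal: "0 < n \<Longrightarrow> odd (jacobsthal n)"
  by (cases n) (auto simp: jacobsthal_Suc)

lemma jacobsthal_pos: "0 < n \<Longrightarrow> 0 < jacobsthal n"
proof (induction n rule: jacobsthal.induct)
  case (3 n)
  then show ?case by (cases n) auto
qed auto

text \<open>An odd number has lowest digit 1 or -1. For \<open>jacobsthal (Suc (Suc n))\<close> one
  choice leaves \<open>jacobsthal (Suc n)\<close> for the remaining digits; the other leaves twice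
  \<open>jacobsthal n\<close>, which may continue with digit 0. The two families have different
  first digits, and their sizes add as in the Fibonacci recurrence.\<close>

lemma fib_le_card_signed_binary: "fib (Suc n) \<le> card (signed_binary n (jacobsthal n))"
proof (induction n rule: jacobsthal.induct)
  case 1
  have "signed_binary 0 0 = {[]}" by (auto simp: signed_binary_def)
  then show ?case by simp
next
  case 2
  have "[1] \<in> signed_binary 1 1" by (auto simp: signed_binary_def)
  then have "card (signed_binary 1 1) \<noteq> 0" using finite_signed_binary by auto
  then show ?case by simp
next
  case (3 n)
  let ?S = "signed_binary (Suc n) (jacobsthal (Suc n))" and ?T = "signed_binary n (jacobsthal n)"
  define d :: int where "d = (-1) ^ Suc n"
  have d: "d \<in> {-1, 1}" by (auto simp: d_def minus_one_power_iff)
  have J: "jacobsthal (Suc (Suc n)) = d + 2 * jacobsthal (Suc n)"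
    "jacobsthal (Suc (Suc n)) = - d + 4 * jacobsthal n"
    using jacobsthal_Suc[of "Suc n"] jacobsthal_Suc[of n] by (auto simp: d_def)
  have "fib (Suc (Suc (Suc n))) \<le> card ?S + card ?T" using 3 by simp
  also have "\<dots> = card ((#) d ` ?S) + card ((\<lambda>ds. - d # 0 # ds) ` ?T)"
    by (simp add: card_image inj_on_def)
  also have "\<dots> = card ((#) d ` ?S \<union> (\<lambda>ds. - d # 0 # ds) ` ?T)"
    using d by (intro card_Un_disjoint[symmetric]) (auto simp: finite_signed_binary)
  also have "\<dots> \<le> card (signed_binary (Suc (Suc n)) (jacobsthal (Suc (Suc n))))"
  proof (intro card_mono finite_signed_binary Un_least image_subsetI)
    show "d # ds \<in> signed_binary (Suc (Suc n)) (jacobsthal (Suc (Suc n)))" if "ds \<in> ?S" for ds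
      using that d unfolding J(1) by (auto simp: signed_binary_def)
    show "- d # 0 # ds \<in> signed_binary (Suc (Suc n)) (jacobsthal (Suc (Suc n)))" if "ds \<in> ?T" for ds
      using that d unfolding J(2) by (auto simp: signed_binary_def)
  qed
  finally show ?case .
qed

text \<open>The weights in \<open>p\<close> are those of binary notation with \<open>N\<close> in
  place of the unit weight, so an expansion of \<open>N\<close> becomes a combination of value
  1.\<close>

lemma card_signed_binary_le:
  fixes e :: "'n::finite \<Rightarrow> nat" and p :: "real ^ 'n"
  assumes e: "bij_betw e UNIV {0..<CARD('n)}" and "odd N"
    and p: "\<And>i. p $ i = of_int (2 ^ e i * (if e i = 0 then N else 1))"
  shows "card (signed_binary CARD('n) N) \<le> card {v \<in> signed_vectors. v \<bullet> p = 1}"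
proof (rule card_inj_on_le)
  let ?n = "CARD('n)"
  \<comment> \<open>\<open>N = d\<^sub>0 + \<Sum>\<^sub>k d\<^sub>k 2^k\<close> over \<open>k \<ge> 1\<close> gives
    \<open>d\<^sub>0 N - \<Sum>\<^sub>k d\<^sub>0 d\<^sub>k 2^k = d\<^sub>0^2 = 1\<close>, since \<open>d\<^sub>0\<close> is odd.\<close>
  define f :: "int list \<Rightarrow> real ^ 'n"
    where "f ds = (\<chi> i. of_int (if e i = 0 then ds ! 0 else - (ds ! 0 * ds ! e i)))" for ds
  have n: "0 < ?n" by simp
  have range: "e i < ?n" for i using bij_betwE[OF e] by simp
  have surj: "\<exists>i. e i = k" if "k < ?n" for k
    using bij_betw_imp_surj_on[OF e] that by (metis atLeastLessThan_iff image_iff le0)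
  have head: "ds ! 0 \<in> {-1, 1}" and tail: "(\<Sum>k=1..<?n. ds ! k * 2 ^ k) = N - ds ! 0"
    and digit: "\<And>k. k < ?n \<Longrightarrow> ds ! k \<in> {-1, 0, 1}"
    if ds: "ds \<in> signed_binary ?n N" for ds
  proof -
    have len: "length ds = ?n" using ds by (simp add: signed_binary_def)
    show dig: "ds ! k \<in> {-1, 0, 1}" if "k < ?n" for k
    proof -
      have "set ds \<subseteq> {-1, 0, 1}" using ds by (simp add: signed_binary_def)
      moreover have "ds ! k \<in> set ds" using that len by simp
      ultimately show ?thesis by blast
    qed
    have "(\<Sum>k=0..<?n. ds ! k * 2 ^ k) = N"
      using ds len by (auto simp: signed_binary_def horner_sum_eq_sum)
    then have sum: "ds ! 0 + (\<Sum>k=1..<?n. ds ! k * 2 ^ k) = N"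
      using n by (subst (asm) sum.atLeast_Suc_lessThan) auto
    then show "(\<Sum>k=1..<?n. ds ! k * 2 ^ k) = N - ds ! 0" by simp
    have "even (\<Sum>k=1..<?n. ds ! k * 2 ^ k)" by (intro dvd_sum) auto
    then have "odd (ds ! 0)" using sum \<open>odd N\<close> by presburger
    then show "ds ! 0 \<in> {-1, 1}" using dig[OF n] by auto
  qed
  show "f ` signed_binary ?n N \<subseteq> {v \<in> signed_vectors. v \<bullet> p = 1}"
  proof (intro image_subsetI CollectI conjI)
    fix ds assume ds: "ds \<in> signed_binary ?n N"
    show "f ds \<in> signed_vectors"
      unfolding signed_vectors_def
    proof (intro CollectI allI)
      fix i show "f ds $ i \<in> {-1, 0, 1}"
        using head[OF ds] digit[OF ds range[of i]] by (auto simp: f_def)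
    qed
    \<comment> \<open>The summand of \<open>f ds \<bullet> p\<close> indexed by exponent, so that
      the sum can be reindexed along \<open>e\<close>.\<close>
    define g where "g k = (if k = 0 then ds ! 0 * N else - (ds ! 0 * (ds ! k * 2 ^ k)))" for k
    have "f ds \<bullet> p = of_int (\<Sum>i\<in>UNIV. g (e i))"
      unfolding inner_vec_def of_int_sum by (intro sum.cong) (auto simp: f_def g_def p)
    also have "(\<Sum>i\<in>UNIV. g (e i)) = (\<Sum>k=0..<?n. g k)"
      by (rule sum.reindex_bij_betw[OF e])
    also have "\<dots> = ds ! 0 * N - ds ! 0 * (\<Sum>k=1..<?n. ds ! k * 2 ^ k)"
      using n by (subst sum.atLeast_Suc_lessThan) (auto simp: g_def sum_negf sum_distrib_left)
    also have "\<dots> = ds ! 0 * ds ! 0" unfolding tail[OF ds] by algebra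
    also have "\<dots> = 1" using head[OF ds] by auto
    finally show "f ds \<bullet> p = 1" by simp
  qed
  show "inj_on f (signed_binary ?n N)"
  proof (intro inj_onI nth_equalityI)
    fix ds ds' assume ds: "ds \<in> signed_binary ?n N" "ds' \<in> signed_binary ?n N" and eq: "f ds = f ds'"
    then show len: "length ds = length ds'" by (simp add: signed_binary_def)
    have eq': "f ds $ i = f ds' $ i" for i using eq by simp
    \<comment> \<open>The entry of exponent 0 recovers the lowest digit; as this is 1 or -1, the
      other entries then determine the other digits.\<close>
    obtain i0 where "e i0 = 0" using surj n by blast
    then have h: "ds ! 0 = ds' ! 0" using eq'[of i0] by (simp add: f_def)
    fix k assume "k < length ds"
    then obtain i where "e i = k" using surj ds by (auto simp: signed_binary_def)
    then show "ds ! k = ds' ! k"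
      using eq'[of i] h head[OF ds(1)] by (auto simp: f_def split: if_splits)
  qed
  show "finite {v \<in> signed_vectors. v \<bullet> p = 1}" by (simp add: finite_signed_vectors)
qed

section \<open>The lower bound\<close>

lemma fib_le_card_facets:
  assumes "CARD('n::finite) \<ge> 2"
  shows "\<exists>R\<in>(positive_regions :: (real ^ 'n) set set).
    fib (CARD('n) + 1) \<le> card (facets (closure R))"
proof -
  obtain e :: "'n \<Rightarrow> nat" where e: "bij_betw e UNIV {0..<CARD('n)}"
    using ex_bij_betw_finite_nat[of "UNIV :: 'n set"] by auto
  then have "inj e" by (simp add: bij_betw_def)
  define N where "N = jacobsthal CARD('n)"
  have N: "odd N" "0 < N"
    unfolding N_def by (rule odd_jacobsthal jacobsthal_pos; simp)+
  define p :: "real ^ 'n" where "p = (\<chi> i. of_int (2 ^ e i * (if e i = 0 then N else 1)))"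
  have p: "p $ i = of_int (2 ^ e i * (if e i = 0 then N else 1))" for i by (simp add: p_def)
  have diff: "\<exists>i. v $ i \<noteq> 0 \<and> u $ i = - v $ i"
    if "u \<in> signed_vectors" "v \<in> signed_vectors" "u \<noteq> v" "u \<bullet> p = v \<bullet> p" for u v
    using N(1) by (intro first_difference_opposite[OF \<open>inj e\<close> _ that(1-3) p that(4)]) simp
  \<comment> \<open>Genericity is the comparison with the zero vector, which has no nonzero
    entry.\<close>
  have "u \<bullet> p \<noteq> 0" if "u \<in> signed_vectors" "u \<noteq> 0" for u
    using diff[of u 0] that by (auto simp: signed_vectors_def)
  then obtain R :: "(real ^ 'n) set" where R: "R \<in> positive_regions"
    "card {v \<in> signed_vectors. v \<bullet> p = 1} \<le> card (facets (closure R))"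
    using card_facets_ge_minimal_differences[OF assms, of p] N diff by (auto simp: p)
  have "fib (CARD('n) + 1) \<le> card (signed_binary CARD('n) N)"
    unfolding N_def using fib_le_card_signed_binary by simp
  also have "\<dots> \<le> card {v \<in> signed_vectors. v \<bullet> p = 1}"
    by (rule card_signed_binary_le[OF e N(1) p])
  finally show ?thesis using R by (meson le_trans)
qed

text \<open>For one atom the projection of \<open>p\<close> is the origin and cannot be rescaled to
  sum 1. The region is a single point, whose empty face of dimension -1 is the one facet required by
  \<open>fib 2 = 1\<close>.\<close>

lemma fib_le_card_facets_1:
  assumes "CARD('n::finite) = 1"
  shows "\<exists>R\<in>(positive_regions :: (real ^ 'n) set set).
    fib (CARD('n) + 1) \<le> card (facets (closure R))"
proof -
  obtain a :: 'n where a: "UNIV = {a}" using assms card_1_singletonE by blast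
  have all: "i = a" for i using a by auto
  let ?U = "{u \<in> signed_vectors. 0 < u \<bullet> (1 :: real ^ 'n)}"
  let ?P = "closed_cell unit_sum_hyperplane ?U"
  have "u \<bullet> 1 \<noteq> 0" if "u \<noteq> 0" for u :: "real ^ 'n"
    using that all by (auto simp: inner_vec_def a vec_eq_iff) metis
  then have R: "open_cell unit_sum_hyperplane ?U \<in> positive_regions"
    and p: "1 /\<^sub>R ((1 :: real ^ 'n) \<bullet> 1) \<in> open_cell unit_sum_hyperplane ?U"
    using open_cell_positive_region[of "1 :: real ^ 'n"] by auto
  have finU: "finite ?U" by (simp add: finite_signed_vectors)
  have "aff_dim ?P = aff_dim (unit_sum_hyperplane :: (real ^ 'n) set)"
    using aff_dim_closed_cell[OF affine_unit_sum_hyperplane finU p] .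
  also have "\<dots> = 0"
    unfolding unit_sum_hyperplane_eq using assms by (subst aff_dim_hyperplane) auto
  finally have "{} \<in> facets ?P" by (simp add: facets_def)
  moreover have "finite (facets ?P)"
    using finite_facets polyhedron_closed_cell[OF affine_unit_sum_hyperplane finU] by blast
  ultimately have "0 < card (facets ?P)"
    using card_gt_0_iff by blast
  then show ?thesis
    using closure_open_cell[OF affine_unit_sum_hyperplane finU p] assms
    by (intro bexI[OF _ R]) simp
qed

theorem mainTheorem2:
  "max_facets TYPE('n::finite) \<ge> fib (CARD('n) + 1)"
proof -
  have "CARD('n) = 1 \<or> CARD('n) \<ge> 2" using zero_less_card_finite[where 'a = 'n] by linarith
  then obtain R :: "(real ^ 'n) set" where "R \<in> positive_regions"
    and "fib (CARD('n) + 1) \<le> card (facets (closure R))"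
    using fib_le_card_facets fib_le_card_facets_1 by blast
  then show ?thesis
    unfolding max_facets_def using finite_positive_regions
    by (meson Max_ge finite_imageI image_eqI le_trans)
qed

end
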